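(* Let $\mathcal U$ be the set of all complete triplets, and for $\mathbf A=(A,\preceq_{\mathbf A},d_{\mathbf A})$, $\mathbf B=(B,\preceq_{\mathbf B},d_{\mathbf B})\in\mathcal U$ define $d_{\mathcal U}(\mathbf A,\mathbf B)=\min\big(d_{\mathbf A}(\max_{\mathbf A},a)+d_{\mathbf B}(\max_{\mathbf B},b)\big)$, the minimum taken over all $a\in A$, $b\in B$ with $a=b$. Then $(\mathcal U,d_{\mathcal U})$ is the generic rational metric space: it is a countable metric space with rational distances, it is ultrahomogeneous (every isometry between finite subspaces extends to an isometry of the whole space onto itself), and every countable metric space with rational distances embeds isometrically into it.
   Context: A triplet is $\mathbf A=(A,\preceq_{\mathbf A},d_{\mathbf A})$ where $A$ is a finite set, $\preceq_{\mathbf A}$ is a partial order on $A$ and $d_{\mathbf A}:A\times A\to\mathbb Q$ is a metric. Triplets are isomorphic if there is a bijection that is simultaneously an order isomorphism and an isometry. For $a\in A$, $\downarrow a=\{b: b\preceq_{\mathbf A} a\}$, regarded as a triplet with the restricted order and metric. A triplet is proper if its down sets $\downarrow a$ ($a\in A$) are pairwise non-isomorphic as triplets and $(A,\preceq_{\mathbf A})$ has a greatest element $\max_{\mathbf A}$ and a smallest element $\min_{\mathbf A}$. A proper triplet is path metric if for all $a,a'\in A$ incomparable in $\preceq_{\mathbf A}$ there is $a''\in A$ with $a''\preceq_{\mathbf A}a$, $a''\preceq_{\mathbf A}a'$ and $d_{\mathbf A}(a,a')=d_{\mathbf A}(a,a'')+d_{\mathbf A}(a'',a')$. A proper path-metric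 triplet is complete if for every $a\in A$ we have $a=\{(b,d_{\mathbf A}(a,b)) : b\in\downarrow a,\ b\neq a\}$ (in particular $\min_{\mathbf A}=\emptyset$); here elements are (hereditarily finite) sets built from such pairs. *)

theory Defs
  imports "HOL-Analysis.Analysis" "HOL-Library.FSet"
begin

(* Metric_space constrains the distance function also off the carrier (nonnegativity and
   symmetry).  Replacing the off-carrier values by 0 makes this a condition on the restriction
   of d to M \<times> M only. *)
definition rational_metric_space :: "'a set \<Rightarrow> ('a \<Rightarrow> 'a \<Rightarrow> rat) \<Rightarrow> bool" where
  "rational_metric_space M d \<longleftrightarrow>
     Metric_space M (\<lambda>x y. if x \<in> M \<and> y \<in> M then real_of_rat (d x y) else 0)"

record 'a triplet =
  points :: "'a set"
  order :: "'a rel"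
  distance :: "'a \<Rightarrow> 'a \<Rightarrow> rat"

(* The distance is a function on points A \<times> points A.  It is normalised to 0 elsewhere, so that
   equality of records is equality of triplets. *)
definition triplet :: "'a triplet \<Rightarrow> bool" where
  "triplet A \<longleftrightarrow>
     finite (points A) \<and>
     partial_order_on (points A) (order A) \<and>
     rational_metric_space (points A) (distance A) \<and>
     (\<forall>x y. \<not> (x \<in> points A \<and> y \<in> points A) \<longrightarrow> distance A x y = 0)"

definition triplet_isomorphic :: "'a triplet \<Rightarrow> 'b triplet \<Rightarrow> bool" where
  "triplet_isomorphic A B \<longleftrightarrow>
     (\<exists>f. bij_betw f (points A) (points B) \<and>
          (\<forall>x\<in>points A. \<forall>y\<in>points A.
             ((x, y) \<in> order A \<longleftrightarrow> (f x, f y) \<in> order B) \<and>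
             distance B (f x) (f y) = distance A x y))"

definition induced :: "'a triplet \<Rightarrow> 'a set \<Rightarrow> 'a triplet" where
  "induced A S =
     \<lparr>points = S,
      order = order A \<inter> S \<times> S,
      distance = (\<lambda>x y. if x \<in> S \<and> y \<in> S then distance A x y else 0)\<rparr>"

definition down :: "'a triplet \<Rightarrow> 'a \<Rightarrow> 'a triplet" where
  "down A a = induced A {b \<in> points A. (b, a) \<in> order A}"

definition is_greatest :: "'a triplet \<Rightarrow> 'a \<Rightarrow> bool" where
  "is_greatest A m \<longleftrightarrow> m \<in> points A \<and> (\<forall>a\<in>points A. (a, m) \<in> order A)"

definition is_smallest :: "'a triplet \<Rightarrow> 'a \<Rightarrow> bool" where
  "is_smallest A m \<longleftrightarrow> m \<in> points A \<and> (\<forall>a\<in>points A. (m, a) \<in> order A)"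

definition max_point :: "'a triplet \<Rightarrow> 'a" where
  "max_point A = (THE m. is_greatest A m)"

definition proper :: "'a triplet \<Rightarrow> bool" where
  "proper A \<longleftrightarrow>
     triplet A \<and>
     (\<forall>a\<in>points A. \<forall>b\<in>points A. a \<noteq> b \<longrightarrow> \<not> triplet_isomorphic (down A a) (down A b)) \<and>
     (\<exists>m. is_greatest A m) \<and> (\<exists>m. is_smallest A m)"

definition path_metric :: "'a triplet \<Rightarrow> bool" where
  "path_metric A \<longleftrightarrow>
     proper A \<and>
     (\<forall>a\<in>points A. \<forall>a'\<in>points A. (a, a') \<notin> order A \<and> (a', a) \<notin> order A \<longrightarrow>
        (\<exists>a''\<in>points A. (a'', a) \<in> order A \<and> (a'', a') \<in> order A \<and>
           distance A a a' = distance A a a'' + distance A a'' a'))"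

(* The hereditarily finite sets all of whose elements are pairs of such a set and a rational.
   By finiteness and well-foundedness these are the only possible points of complete triplets. *)
datatype hfset = HF (elems: "(hfset \<times> rat) fset")

definition complete_triplet :: "hfset triplet \<Rightarrow> bool" where
  "complete_triplet A \<longleftrightarrow>
     path_metric A \<and>
     (\<forall>a\<in>points A. fset (elems a) =
        {(b, distance A a b) | b. b \<in> points (down A a) \<and> b \<noteq> a})"

definition complete_triplets :: "hfset triplet set" where
  "complete_triplets = {A. complete_triplet A}"

definition triplet_dist :: "hfset triplet \<Rightarrow> hfset triplet \<Rightarrow> rat" where
  "triplet_dist A B =
     Min {distance A (max_point A) a + distance B (max_point B) b | a b.
            a \<in> points A \<and> b \<in> points B \<and> a = b}"

definition isometry :: "'a set \<Rightarrow> ('a \<Rightarrow> 'a \<Rightarrow> rat) \<Rightarrow> 'b set \<Rightarrow> ('b \<Rightarrow> 'b \<Rightarrow> rat) \<Rightarrow> ('a \<Rightarrow> 'b) \<Rightarrow> bool" where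
  "isometry M d N e f \<longleftrightarrow>
     bij_betw f M N \<and> (\<forall>x\<in>M. \<forall>y\<in>M. e (f x) (f y) = d x y)"

definition ultrahomogeneous :: "'a set \<Rightarrow> ('a \<Rightarrow> 'a \<Rightarrow> rat) \<Rightarrow> bool" where
  "ultrahomogeneous M d \<longleftrightarrow>
     (\<forall>S T f. S \<subseteq> M \<and> T \<subseteq> M \<and> finite S \<and> finite T \<and> isometry S d T d f \<longrightarrow>
        (\<exists>g. isometry M d M d g \<and> (\<forall>x\<in>S. g x = f x)))"

definition embeds_isometrically :: "'a set \<Rightarrow> ('a \<Rightarrow> 'a \<Rightarrow> rat) \<Rightarrow> 'b set \<Rightarrow> ('b \<Rightarrow> 'b \<Rightarrow> rat) \<Rightarrow> bool" where
  "embeds_isometrically M d N e \<longleftrightarrow> (\<exists>f. f ` M \<subseteq> N \<and> isometry M d (f ` M) e f)"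

end

theory Submission
  imports Defs
begin

text \<open>In a complete triplet the order and the distances between comparable points are read off the
  points themselves, and the remaining distances are the minima of the two-step distances through
  common lower bounds.  So a complete triplet is determined by its maximum, any two complete triplets
  agree on their common points, and \<open>d\<^sub>U\<close> restricted to the down sets of a triplet \<open>A\<close> is the metric
  of \<open>A\<close>.  A one-point extension of a finite subspace is a Katetov function; it is realised by placing
  a new maximum on top of the union of the triplets involved.  This extension property yields
  ultrahomogeneity and universality by back and forth.\<close>

section \<open>Rational metric spaces\<close>

text \<open>The prescribed function gives distances only to the maxima of the chosen triplets,
  whereas a new maximum needs a distance to every point of their union. Every point of a triplet is
  the maximum of its own down set, again a complete triplet, so the union can be treated as a set of
  elements of the space, and extending the Katetov function to the whole space supplies the missing
  values. No separate amalgamation is needed: \<open>triplet_dist\<close> already measures points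
  lying in different triplets, and the minimum in its definition is attained at a common lower
  bound, which is what the path condition asks for. The same condition, applied in the middle
  triplet, gives the triangle inequality for \<open>triplet_dist\<close>, where the two minima may
  be attained at different points.\<close>

lemma rational_metric_spaceI:
  assumes "\<And>x y. x \<in> M \<Longrightarrow> y \<in> M \<Longrightarrow> d x y = d y x"
    and "\<And>x y. x \<in> M \<Longrightarrow> y \<in> M \<Longrightarrow> d x y = 0 \<longleftrightarrow> x = y"
    and "\<And>x y z. x \<in> M \<Longrightarrow> y \<in> M \<Longrightarrow> z \<in> M \<Longrightarrow> d x z \<le> d x y + d y z"
  shows "rational_metric_space M d"
proof -
  \<comment> \<open>Nonnegativity comes from \<open>0 = d x x \<le> d x y + d y x\<close> and
    symmetry.\<close>
  have "0 \<le> d x y" if "x \<in> M" "y \<in> M" for x y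
    using assms(1,2)[of x y] assms(2)[of x x] assms(3)[of x y x] that by auto
  then show ?thesis
    unfolding rational_metric_space_def Metric_space_def
    using assms by (auto simp flip: of_rat_add simp: of_rat_less_eq)
qed

lemma rational_metric_spaceD:
  assumes "rational_metric_space M d" "x \<in> M" "y \<in> M"
  shows "0 \<le> d x y" "d x y = d y x" "d x y = 0 \<longleftrightarrow> x = y"
    and "z \<in> M \<Longrightarrow> d x z \<le> d x y + d y z"
proof -
  interpret Metric_space M "\<lambda>x y. if x \<in> M \<and> y \<in> M then real_of_rat (d x y) else 0"
    using assms(1) by (simp add: rational_metric_space_def)
  show "0 \<le> d x y" "d x y = d y x" "d x y = 0 \<longleftrightarrow> x = y"
    using nonneg[of x y] commute[of x y] zero[of x y] assms(2,3) by (simp_all split: if_splits)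
  show "d x z \<le> d x y + d y z" if "z \<in> M"
    using triangle[of x y z] assms(2,3) that by (simp flip: of_rat_add add: of_rat_less_eq)
qed

lemma rational_metric_space_cong:
  assumes "\<And>x y. x \<in> M \<Longrightarrow> y \<in> M \<Longrightarrow> d x y = e x y"
  shows "rational_metric_space M d \<longleftrightarrow> rational_metric_space M e"
proof -
  have "(\<lambda>x y. if x \<in> M \<and> y \<in> M then real_of_rat (d x y) else 0) =
        (\<lambda>x y. if x \<in> M \<and> y \<in> M then real_of_rat (e x y) else 0)"
    using assms by (auto simp: fun_eq_iff)
  then show ?thesis by (simp add: rational_metric_space_def)
qed

lemma rational_metric_space_inj_image:
  assumes "rational_metric_space M d" "inj_on h N" "h ` N \<subseteq> M"
  shows "rational_metric_space N (\<lambda>x y. d (h x) (h y))"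
proof (rule rational_metric_spaceI)
  fix x y z assume "x \<in> N" "y \<in> N" "z \<in> N"
  then show "d (h x) (h z) \<le> d (h x) (h y) + d (h y) (h z)"
    using rational_metric_spaceD(4)[OF assms(1)] assms(3) by blast
next
  fix x y assume "x \<in> N" "y \<in> N"
  then have "h x \<in> M" "h y \<in> M" "h x = h y \<longleftrightarrow> x = y"
    using assms(2,3) by (auto dest: inj_onD)
  then show "d (h x) (h y) = d (h y) (h x)" "d (h x) (h y) = 0 \<longleftrightarrow> x = y"
    using rational_metric_spaceD(2,3)[OF assms(1)] by blast+
qed

lemma rational_metric_space_subset:
  "rational_metric_space M d \<Longrightarrow> N \<subseteq> M \<Longrightarrow> rational_metric_space N d"
  using rational_metric_space_inj_image[of M d "\<lambda>x. x" N] by simp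

text \<open>These are the one-point extensions of \<open>M\<close>: \<open>f x\<close> is the
  distance from \<open>x\<close> to an added point, and strict positivity keeps that point outside
  \<open>M\<close>.\<close>

definition katetov :: "'a set \<Rightarrow> ('a \<Rightarrow> 'a \<Rightarrow> rat) \<Rightarrow> ('a \<Rightarrow> rat) \<Rightarrow> bool" where
  "katetov M d f \<longleftrightarrow>
     (\<forall>x\<in>M. 0 < f x) \<and> (\<forall>x\<in>M. \<forall>y\<in>M. f x \<le> d x y + f y \<and> d x y \<le> f x + f y)"

text \<open>The extension used is the largest possible: \<open>g y\<close> is the length of a
  shortest path from \<open>y\<close> through \<open>F\<close> to the added point. As
  \<open>F\<close> is finite and nonempty, the minimum is attained, which keeps \<open>g\<close>
  positive.\<close>

lemma katetov_extend:
  assumes "rational_metric_space M d" "F \<subseteq> M" "finite F" "F \<noteq> {}" "katetov F d f"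
  obtains g where "katetov M d g" "\<And>x. x \<in> F \<Longrightarrow> g x = f x"
proof
  define g where "g = (\<lambda>y. Min ((\<lambda>x. d y x + f x) ` F))"
  have le: "g y \<le> d y x + f x" if "x \<in> F" for x y
    unfolding g_def using assms(3) that by simp
  have att: "\<exists>x\<in>F. g y = d y x + f x" for y
  proof -
    have "g y \<in> (\<lambda>x. d y x + f x) ` F"
      unfolding g_def using assms(3,4) by (intro Min_in) auto
    then show ?thesis by blast
  qed
  note m = rational_metric_spaceD[OF assms(1)]
  have f: "0 < f x" "f x \<le> d x y + f y" "d x y \<le> f x + f y" if "x \<in> F" "y \<in> F" for x y
    using assms(5) that unfolding katetov_def by blast+
  show "g x = f x" if "x \<in> F" for x
  proof (rule antisym)
    have "d x x = 0" using m(3)[of x x] that assms(2) by auto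
    then show "g x \<le> f x" using le[OF that, of x] by simp
    obtain y where "y \<in> F" "g x = d x y + f y" using att by blast
    then show "f x \<le> g x" using f(2)[OF that] by simp
  qed
  show "katetov M d g"
    unfolding katetov_def
  proof (intro conjI ballI)
    fix y assume y: "y \<in> M"
    obtain x where x: "x \<in> F" "g y = d y x + f x" using att by blast
    then show "0 < g y" using m(1)[of y x] y f(1)[of x] assms(2) by fastforce
    fix y' assume y': "y' \<in> M"
    obtain x' where x': "x' \<in> F" "g y' = d y' x' + f x'" using att by blast
    have X: "x \<in> M" "x' \<in> M" using x x' assms(2) by auto
    show "g y \<le> d y y' + g y'"
      using le[OF x'(1), of y] m(4)[OF y y' X(2)] x'(2) by simp
    \<comment> \<open>The path from \<open>y\<close> to \<open>y'\<close> runs through both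
      minimisers; \<open>d x x' \<le> f x + f x'\<close> bounds its middle segment.\<close>
    have "d y y' \<le> d y x + d x y'" using m(4)[OF y X(1) y'] .
    also have "d x y' \<le> d x x' + d x' y'" using m(4)[OF X y'] .
    finally show "d y y' \<le> g y + g y'"
      using f(3)[OF x(1) x'(1)] m(2)[OF X(2) y'] x(2) x'(2) by simp
  qed
qed

text \<open>The first Katetov inequality is the triangle inequality with \<open>z\<close> at one
  end, the second the one with \<open>z\<close> in the middle. The test \<open>x = y\<close> comes
  first, so the diagonal is 0 whatever \<open>f z\<close> is.\<close>

lemma rational_metric_space_insert:
  assumes "rational_metric_space M d" "katetov M d f" "z \<notin> M"
  shows "rational_metric_space (insert z M)
    (\<lambda>x y. if x = y then 0 else if x = z then f y else if y = z then f x else d x y)"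
    (is "rational_metric_space _ ?e")
proof (rule rational_metric_spaceI)
  note m = rational_metric_spaceD[OF assms(1)]
  have f: "0 < f x" "f x \<le> d x y + f y" "d x y \<le> f x + f y" if "x \<in> M" "y \<in> M" for x y
    using assms(2) that unfolding katetov_def by blast+
  fix x y assume xy: "x \<in> insert z M" "y \<in> insert z M"
  show "?e x y = ?e y x" using xy m(2)[of x y] by auto
  show "?e x y = 0 \<longleftrightarrow> x = y"
    using xy m(3)[of x y] f(1)[of x x] f(1)[of y y] by auto
  fix w assume w: "w \<in> insert z M"
  show "?e x w \<le> ?e x y + ?e y w"
  proof (cases "x = y \<or> y = w")
    case False
    then consider "x = z" "y \<in> M" "w = z" | "x = z" "y \<in> M" "w \<in> M" "w \<noteq> z"
      | "y = z" "x \<in> M" "w \<in> M" | "w = z" "x \<in> M" "y \<in> M" "x \<noteq> z"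
      | "x \<in> M" "y \<in> M" "w \<in> M" "x \<noteq> z" "y \<noteq> z" "w \<noteq> z"
      using xy w assms(3) by blast
    then show ?thesis
    proof cases
      case 1
      then show ?thesis using False f(1)[of y y] by simp
    next
      case 2
      then show ?thesis using assms(3) f(2)[of w y] m(2)[of w y] by auto
    next
      case 3
      then show ?thesis using assms(3) f(1)[of x x] f(3)[of x w] by auto
    next
      case 4
      then show ?thesis using assms(3) f(2)[of x y] by auto
    next
      case 5
      then show ?thesis using m(1)[of x y] m(1)[of y w] m(4)[of x y w] by auto
    qed
  qed auto
qed

section \<open>Back and forth\<close>

text \<open>\<open>F\<close> is nonempty because a Katetov function will be extended by a minimum
  over \<open>F\<close>. The start of a back and forth, where no distance is prescribed yet, is
  covered by \<open>M \<noteq> {}\<close>.\<close>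

definition extension_property :: "'a set \<Rightarrow> ('a \<Rightarrow> 'a \<Rightarrow> rat) \<Rightarrow> bool" where
  "extension_property M d \<longleftrightarrow> M \<noteq> {} \<and>
     (\<forall>F f. finite F \<and> F \<subseteq> M \<and> F \<noteq> {} \<and> katetov F d f \<longrightarrow> (\<exists>z\<in>M. \<forall>x\<in>F. d z x = f x))"

text \<open>Partial isometries are relations, not functions, so that the back step is the forth step for the
  converse relation.\<close>

definition partial_isometry ::
  "'a set \<Rightarrow> ('a \<Rightarrow> 'a \<Rightarrow> rat) \<Rightarrow> 'b set \<Rightarrow> ('b \<Rightarrow> 'b \<Rightarrow> rat) \<Rightarrow> ('a \<times> 'b) set \<Rightarrow> bool" where
  "partial_isometry M d N e R \<longleftrightarrow>
     R \<subseteq> M \<times> N \<and> (\<forall>x y x' y'. (x, y) \<in> R \<longrightarrow> (x', y') \<in> R \<longrightarrow> e y y' = d x x')"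

lemma partial_isometryD:
  assumes "partial_isometry M d N e R" "(x, y) \<in> R"
  shows "x \<in> M" "y \<in> N" "(x', y') \<in> R \<Longrightarrow> e y y' = d x x'"
  using assms unfolding partial_isometry_def by blast+

lemma partial_isometry_Domain_Range:
  assumes "partial_isometry M d N e R"
  shows "Domain R \<subseteq> M" "Range R \<subseteq> N"
  using assms unfolding partial_isometry_def by auto

lemma partial_isometry_converse:
  "partial_isometry M d N e R \<Longrightarrow> partial_isometry N e M d (R\<inverse>)"
  unfolding partial_isometry_def by auto

text \<open>Distance zero detects equality on both sides, so a partial isometry is the graph of an
  injective function.\<close>

lemma partial_isometry_inject:
  assumes "rational_metric_space M d" "rational_metric_space N e" "partial_isometry M d N e R"
    and "(x, y) \<in> R" "(x', y') \<in> R"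
  shows "x = x' \<longleftrightarrow> y = y'"
proof -
  have "x \<in> M" "x' \<in> M" "y \<in> N" "y' \<in> N" "e y y' = d x x'"
    using assms(3-5) unfolding partial_isometry_def by auto
  then show ?thesis
    using rational_metric_spaceD(3)[OF assms(1), of x x'] rational_metric_spaceD(3)[OF assms(2), of y y']
    by simp
qed

text \<open>The distances from \<open>p\<close> to the domain, transported along \<open>R\<close>,
  form a Katetov function on the range, and a point realising it is a partner for \<open>p\<close>.
  A \<open>p\<close> already in the domain is treated apart, since the function would vanish at its
  partner.\<close>

lemma partial_isometry_extend:
  assumes M: "rational_metric_space M d" and N: "rational_metric_space N e"
    and ext: "extension_property N e"
    and R: "partial_isometry M d N e R" "finite R" and p: "p \<in> M"
  obtains q where "partial_isometry M d N e (insert (p, q) R)"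
proof (cases "p \<in> Domain R")
  case True
  then obtain q where "(p, q) \<in> R" by blast
  then show ?thesis using that[of q] R(1) by (simp add: insert_absorb)
next
  case False
  note mM = rational_metric_spaceD[OF M] and mN = rational_metric_spaceD[OF N]
  note pD = partial_isometryD[OF R(1)]
  define f where "f y = d p (SOME x. (x, y) \<in> R)" for y
  have f: "f y = d p x" if "(x, y) \<in> R" for x y
    unfolding f_def using someI[of "\<lambda>x. (x, y) \<in> R", OF that]
      partial_isometry_inject[OF M N R(1) that] by metis
  have "\<exists>q\<in>N. \<forall>y\<in>Range R. e q y = f y"
  proof (cases "R = {}")
    case True
    then show ?thesis using ext unfolding extension_property_def by auto
  next
    case False
    have "katetov (Range R) e f"
      unfolding katetov_def
    proof (intro conjI ballI)
      fix y assume "y \<in> Range R"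
      then obtain x where x: "(x, y) \<in> R" by blast
      show "0 < f y"
        using f[OF x] mM(1,3)[OF p pD(1)[OF x]] \<open>p \<notin> Domain R\<close> x
        by (metis Domain.DomainI order_le_neq_trans)
      fix y' assume "y' \<in> Range R"
      then obtain x' where x': "(x', y') \<in> R" by blast
      have e: "e y y' = d x x'" "f y = d p x" "f y' = d p x'" and X: "x \<in> M" "x' \<in> M"
        using pD x x' f by blast+
      show "f y \<le> e y y' + f y'" "e y y' \<le> f y + f y'"
        unfolding e using mM(4)[OF p X(2) X(1)] mM(4)[OF X(1) p X(2)] mM(2)[OF X] mM(2)[OF p X(1)]
        by simp_all
    qed
    moreover have "finite (Range R)" "Range R \<subseteq> N" "Range R \<noteq> {}"
      using R(2) pD False by (auto simp: finite_Range)
    ultimately show ?thesis using ext unfolding extension_property_def by blast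
  qed
  then obtain q where q: "q \<in> N" "\<And>y. y \<in> Range R \<Longrightarrow> e q y = f y" by blast
  have "partial_isometry M d N e (insert (p, q) R)"
    unfolding partial_isometry_def
  proof (intro conjI allI impI)
    show "insert (p, q) R \<subseteq> M \<times> N" using p q(1) pD by auto
    have pq: "e q y = d p x" "e y q = d x p" if "(x, y) \<in> R" for x y
    proof -
      show "e q y = d p x" using q(2)[of y] f[OF that] that by auto
      then show "e y q = d x p" using mN(2)[OF q(1) pD(2)[OF that]] mM(2)[OF p pD(1)[OF that]] by simp
    qed
    have "e q q = d p p" using mM(3)[OF p p] mN(3)[OF q(1) q(1)] by simp
    then show "e y y' = d x x'" if "(x, y) \<in> insert (p, q) R" "(x', y') \<in> insert (p, q) R" for x y x' y'
      using that pq pD(3) by auto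
  qed
  then show ?thesis by (rule that)
qed

lemma increasing_sequence_meeting_demands:
  assumes "countable C" "P R0"
    and step: "\<And>c R. c \<in> C \<Longrightarrow> P R \<Longrightarrow> \<exists>R'. R \<subseteq> R' \<and> P R' \<and> Q c R'"
  shows "\<exists>r :: nat \<Rightarrow> 'a set.
    r 0 = R0 \<and> (\<forall>n. P (r n)) \<and> mono r \<and> (\<forall>c\<in>C. \<exists>n. Q c (r n))"
proof (cases "C = {}")
  case True
  then show ?thesis using assms(2) by (intro exI[of _ "\<lambda>_. R0"]) (simp add: monoI)
next
  case False
  let ?c = "from_nat_into C"
  \<comment> \<open>Stage \<open>Suc n\<close> serves the \<open>n\<close>-th element of an
    enumeration of \<open>C\<close>. The conjunct \<open>n = 0 \<longrightarrow> r n = R0\<close>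
    pins down the start, which dependent choice otherwise leaves open.\<close>
  have "\<exists>r. \<forall>n. (P (r n) \<and> (n = 0 \<longrightarrow> r n = R0)) \<and> (r n \<subseteq> r (Suc n) \<and> Q (?c n) (r (Suc n)))"
  proof (rule dependent_nat_choice)
    fix R and n :: nat assume "P R \<and> (n = 0 \<longrightarrow> R = R0)"
    then show "\<exists>R'. (P R' \<and> (Suc n = 0 \<longrightarrow> R' = R0)) \<and> (R \<subseteq> R' \<and> Q (?c n) R')"
      using step[OF from_nat_into[OF False, of n], of R] by auto
  qed (use assms(2) in auto)
  then obtain r :: "nat \<Rightarrow> 'a set" where r: "\<And>n. P (r n)" "r 0 = R0" "\<And>n. r n \<subseteq> r (Suc n)" "\<And>n. Q (?c n) (r (Suc n))"
    by blast
  show ?thesis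
  proof (intro exI[of _ r] conjI ballI)
    show "mono r" using r(3) by (simp add: mono_iff_le_Suc)
    show "\<exists>n. Q c (r n)" if "c \<in> C" for c
      using r(4) from_nat_into_surj[OF assms(1) that] by metis
  qed (use r in auto)
qed

lemma partial_isometry_UN:
  assumes "mono r" "\<And>n::nat. partial_isometry M d N e (r n)"
  shows "partial_isometry M d N e (\<Union>n. r n)"
  unfolding partial_isometry_def
proof (intro conjI allI impI)
  show "(\<Union>n. r n) \<subseteq> M \<times> N" using assms(2) unfolding partial_isometry_def by blast
  fix x y x' y' assume "(x, y) \<in> (\<Union>n. r n)" "(x', y') \<in> (\<Union>n. r n)"
  then obtain m n where "(x, y) \<in> r m" "(x', y') \<in> r n" by blast
  then have "(x, y) \<in> r (max m n)" "(x', y') \<in> r (max m n)"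
    using monoD[OF assms(1), of m "max m n"] monoD[OF assms(1), of n "max m n"] by auto
  then show "e y y' = d x x'" using partial_isometryD(3)[OF assms(2)] by blast
qed

lemma total_partial_isometry_function:
  assumes M: "rational_metric_space M d" and N: "rational_metric_space N e"
    and R: "partial_isometry M d N e R" and dom: "Domain R = M"
  shows "\<exists>g. isometry M d (Range R) e g \<and> (\<forall>x y. (x, y) \<in> R \<longrightarrow> g x = y)"
proof -
  note inj = partial_isometry_inject[OF M N R]
  define g where "g x = (SOME y. (x, y) \<in> R)" for x
  have g: "g x = y" if "(x, y) \<in> R" for x y
    unfolding g_def using someI[of "\<lambda>y. (x, y) \<in> R", OF that] inj[OF that] by metis
  have gR: "(x, g x) \<in> R" if "x \<in> M" for x
    using g that dom by blast
  have "isometry M d (Range R) e g"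
    unfolding isometry_def
  proof (intro conjI ballI)
    have "inj_on g M" using inj gR by (metis inj_onI)
    moreover have "g ` M = Range R" using g gR dom by force
    ultimately show "bij_betw g M (Range R)" by (simp add: bij_betw_def)
    show "e (g x) (g y) = d x y" if "x \<in> M" "y \<in> M" for x y
      using partial_isometryD(3)[OF R] gR that by blast
  qed
  then show ?thesis using g by blast
qed

text \<open>Only the forth direction is needed: starting from the empty relation, every point of
  \<open>M\<close> is put into the domain, while the range may stay a proper part of
  \<open>N\<close>.\<close>

lemma extension_property_imp_universal:
  fixes M :: "'a set" and N :: "'b set"
  assumes M: "rational_metric_space M d" "countable M"
    and N: "rational_metric_space N e" "extension_property N e"
  shows "embeds_isometrically M d N e"
proof -
  let ?P = "\<lambda>R. partial_isometry M d N e R \<and> finite R"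
  have P0: "?P {}" by (simp add: partial_isometry_def)
  have step: "\<exists>R'. R \<subseteq> R' \<and> ?P R' \<and> p \<in> Domain R'" if "p \<in> M" "?P R" for p R
    using partial_isometry_extend[OF M(1) N, of R p] that
    by (metis Domain.DomainI finite_insert insertI1 subset_insertI)
  obtain r :: "nat \<Rightarrow> ('a \<times> 'b) set" where "r 0 = {}" and r: "\<And>n. ?P (r n)" "mono r" "\<And>p. p \<in> M \<Longrightarrow> \<exists>n. p \<in> Domain (r n)"
    using increasing_sequence_meeting_demands[of M ?P "{}" "\<lambda>p R. p \<in> Domain R", OF M(2) P0 step]
    by blast
  define W where "W = (\<Union>n. r n)"
  have W: "partial_isometry M d N e W"
    unfolding W_def using r(1,2) by (intro partial_isometry_UN) auto
  have "Domain W = M"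
    using r(3) by (intro antisym partial_isometry_Domain_Range(1)[OF W]) (auto simp: W_def Domain_Union)
  then obtain g where "isometry M d (Range W) e g"
    using total_partial_isometry_function[OF M(1) N(1) W] by blast
  moreover from this have "g ` M = Range W"
    by (simp add: isometry_def bij_betw_def)
  moreover have "Range W \<subseteq> N" by (rule partial_isometry_Domain_Range(2)[OF W])
  ultimately show ?thesis unfolding embeds_isometrically_def by metis
qed

text \<open>The demand at \<open>p\<close> is to lie in the domain and in the range, so the limit is
  onto. The graph of the given isometry is stage 0, hence contained in the limit.\<close>

lemma extension_property_imp_ultrahomogeneous:
  fixes M :: "'a set"
  assumes M: "rational_metric_space M d" "countable M" "extension_property M d"
  shows "ultrahomogeneous M d"
  unfolding ultrahomogeneous_def
proof (intro allI impI, elim conjE)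
  fix S T f assume S: "S \<subseteq> M" "T \<subseteq> M" "finite S" "finite T" and f: "isometry S d T d f"
  let ?P = "\<lambda>R. partial_isometry M d M d R \<and> finite R"
  let ?R0 = "(\<lambda>x. (x, f x)) ` S"
  have P0: "?P ?R0"
    using S f unfolding partial_isometry_def isometry_def bij_betw_def by auto
  have step: "\<exists>R'. R \<subseteq> R' \<and> ?P R' \<and> (p \<in> Domain R' \<and> p \<in> Range R')" if p: "p \<in> M" and R: "?P R" for p R
  proof -
    obtain q where "partial_isometry M d M d (insert (p, q) R)"
      using partial_isometry_extend[OF M(1,1,3) _ _ p] R by blast
    then have q: "?P (insert (p, q) R)" using R by simp
    let ?R = "insert (p, q) R"
    \<comment> \<open>The back step: extending the converse at \<open>p\<close> and reversing again
      puts \<open>p\<close> into the range.\<close>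
    have "partial_isometry M d M d (?R\<inverse>)" "finite (?R\<inverse>)"
      using q partial_isometry_converse by (blast, simp)
    then obtain q' where "partial_isometry M d M d (insert (p, q') (?R\<inverse>))"
      by (rule partial_isometry_extend[OF M(1,1,3) _ _ p])
    then have "partial_isometry M d M d ((insert (p, q') (?R\<inverse>))\<inverse>)"
      by (rule partial_isometry_converse)
    moreover have "(insert (p, q') (?R\<inverse>))\<inverse> = insert (q', p) ?R" by auto
    ultimately have "?P (insert (q', p) ?R)" using q by simp
    then show ?thesis by (intro exI[of _ "insert (q', p) (insert (p, q) R)"]) auto
  qed
  obtain r :: "nat \<Rightarrow> ('a \<times> 'a) set" where r: "r 0 = ?R0" "\<And>n. ?P (r n)" "mono r"
      "\<And>p. p \<in> M \<Longrightarrow> \<exists>n. p \<in> Domain (r n) \<and> p \<in> Range (r n)"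
    using increasing_sequence_meeting_demands
      [of M ?P ?R0 "\<lambda>p R. p \<in> Domain R \<and> p \<in> Range R", OF M(2) P0 step]
    by blast
  define W where "W = (\<Union>n. r n)"
  have W: "partial_isometry M d M d W"
    unfolding W_def using r(2,3) by (intro partial_isometry_UN) auto
  have "p \<in> Domain W \<and> p \<in> Range W" if "p \<in> M" for p
    using r(4)[OF that] by (auto simp: W_def Domain_Union Range_Union)
  then have "Domain W = M" "Range W = M"
    using partial_isometry_Domain_Range[OF W] by auto
  then obtain g where g: "isometry M d M d g" "\<And>x y. (x, y) \<in> W \<Longrightarrow> g x = y"
    using total_partial_isometry_function[OF M(1,1) W] by metis
  have "(x, f x) \<in> W" if "x \<in> S" for x using r(1) that unfolding W_def by blast
  then show "\<exists>g. isometry M d M d g \<and> (\<forall>x\<in>S. g x = f x)" using g by blast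
qed

section \<open>Complete triplets\<close>

instance hfset :: countable
  by countable_datatype

definition preds :: "hfset \<Rightarrow> hfset set" where
  "preds a = fst ` fset (elems a)"

text \<open>Unlike \<open>down A a\<close>, this depends on the point alone; for a point of a
  complete triplet it is the carrier of its down set.\<close>

definition dn :: "hfset \<Rightarrow> hfset set" where
  "dn a = insert a (preds a)"

lemma dn_refl [simp]: "a \<in> dn a"
  by (simp add: dn_def)

lemma finite_dn [simp]: "finite (dn a)"
  by (simp add: dn_def preds_def)

lemma preds_bot [simp]: "preds (HF {||}) = {}"
  by (simp add: preds_def)

lemma hfset_preds_induct:
  assumes "\<And>a. (\<And>b. b \<in> preds a \<Longrightarrow> P b) \<Longrightarrow> P a"
  shows "P a"
proof (induction a)
  case (HF S)
  show ?case
  proof (rule assms)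
    fix b assume "b \<in> preds (HF S)"
    then obtain p where "p |\<in>| S" "b = fst p" by (auto simp: preds_def)
    then show "P b" using HF[of p b] by (cases p) simp
  qed
qed

text \<open>Well-foundedness makes \<open>preds\<close> irreflexive and \<open>dn\<close>
  antisymmetric on all of \<open>hfset\<close>, with no reference to a triplet.\<close>

lemma wf_preds: "wf {(b, a). b \<in> preds a}"
proof (rule wfUNIVI)
  fix P x assume "\<forall>x. (\<forall>y. (y, x) \<in> {(b, a). b \<in> preds a} \<longrightarrow> P y) \<longrightarrow> P x"
  then show "P x" by (intro hfset_preds_induct[of P x]) simp
qed

lemma preds_irrefl: "a \<notin> preds a"
  using wf_not_refl[OF wf_preds, of a] by simp

lemma dn_antisym: "a \<in> dn b \<Longrightarrow> b \<in> dn a \<Longrightarrow> a = b"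
  using wf_asym[OF wf_preds, of a b] by (auto simp: dn_def)

section \<open>Order, distance and extreme points of a complete triplet\<close>

lemma is_greatest_max_point:
  assumes "triplet A" "is_greatest A m"
  shows "max_point A = m"
  unfolding max_point_def
proof (rule the_equality)
  have "antisym (order A)" using assms(1) by (simp add: triplet_def partial_order_on_def)
  moreover fix m' assume "is_greatest A m'"
  then have "(m, m') \<in> order A" "(m', m) \<in> order A"
    using assms(2) by (simp_all add: is_greatest_def)
  ultimately show "m' = m" by (blast dest: antisymD)
qed (rule assms(2))

context
  fixes A :: "hfset triplet"
  assumes A: "complete_triplet A"
begin

lemma complete_triplet_metric: "rational_metric_space (points A) (distance A)"
  using A unfolding complete_triplet_def path_metric_def proper_def triplet_def by simp

lemma complete_triplet_distance_off:
  "\<not> (x \<in> points A \<and> y \<in> points A) \<Longrightarrow> distance A x y = 0"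
  using A unfolding complete_triplet_def path_metric_def proper_def triplet_def by simp

lemma complete_triplet_partial_order:
  shows "order A \<subseteq> points A \<times> points A"
    and "a \<in> points A \<Longrightarrow> (a, a) \<in> order A"
    and "(a, b) \<in> order A \<Longrightarrow> (b, c) \<in> order A \<Longrightarrow> (a, c) \<in> order A"
proof -
  have "partial_order_on (points A) (order A)"
    using A unfolding complete_triplet_def path_metric_def proper_def triplet_def by simp
  then have *: "order A \<subseteq> points A \<times> points A" "refl_on (points A) (order A)" "Relation.trans (order A)"
    by (simp_all add: partial_order_on_def preorder_on_def)
  show "order A \<subseteq> points A \<times> points A" by (rule *(1))
  show "a \<in> points A \<Longrightarrow> (a, a) \<in> order A" using *(2) by (rule refl_onD)
  show "(a, b) \<in> order A \<Longrightarrow> (b, c) \<in> order A \<Longrightarrow> (a, c) \<in> order A" using *(3) by (rule transD)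
qed

lemma complete_triplet_elems_iff:
  assumes "a \<in> points A"
  shows "(b, r) \<in> fset (elems a) \<longleftrightarrow>
    b \<in> points A \<and> (b, a) \<in> order A \<and> b \<noteq> a \<and> r = distance A a b"
  using A assms unfolding complete_triplet_def by (auto simp: down_def induced_def)

lemma complete_triplet_order_iff:
  assumes "a \<in> points A"
  shows "(b, a) \<in> order A \<longleftrightarrow> b \<in> dn a"
proof -
  have "(b, a) \<in> order A \<Longrightarrow> b \<in> points A" "(a, a) \<in> order A"
    using complete_triplet_partial_order(1) complete_triplet_partial_order(2)[OF assms] by auto
  moreover have "b \<in> preds a \<longleftrightarrow> (\<exists>r. (b, r) \<in> fset (elems a))"
    by (force simp: preds_def)
  then have "b \<in> preds a \<longleftrightarrow> b \<in> points A \<and> (b, a) \<in> order A \<and> b \<noteq> a"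
    by (simp add: complete_triplet_elems_iff[OF assms])
  ultimately show ?thesis by (auto simp: dn_def)
qed

lemma complete_triplet_dn_subset: "a \<in> points A \<Longrightarrow> dn a \<subseteq> points A"
  using complete_triplet_order_iff[of a] complete_triplet_partial_order(1) by auto

lemma complete_triplet_order: "order A = {(b, a). a \<in> points A \<and> b \<in> dn a}"
  using complete_triplet_order_iff complete_triplet_partial_order(1) by auto

lemma complete_triplet_dn_trans:
  assumes "a \<in> points A" "b \<in> dn a"
  shows "dn b \<subseteq> dn a"
proof
  fix c assume "c \<in> dn b"
  moreover have "b \<in> points A" using complete_triplet_dn_subset assms by auto
  ultimately have "(c, b) \<in> order A" "(b, a) \<in> order A"
    using assms by (simp_all add: complete_triplet_order_iff)
  then have "(c, a) \<in> order A" by (rule complete_triplet_partial_order(3))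
  then show "c \<in> dn a" using assms by (simp add: complete_triplet_order_iff)
qed

lemma complete_triplet_max_point: "max_point A \<in> points A" "points A = dn (max_point A)"
proof -
  have "\<exists>m. is_greatest A m" "triplet A"
    using A unfolding complete_triplet_def path_metric_def proper_def by simp_all
  then obtain m where m: "is_greatest A m" and "triplet A" by blast
  then have max: "max_point A = m" by (simp add: is_greatest_max_point)
  with m show *: "max_point A \<in> points A" by (simp add: is_greatest_def)
  show "points A = dn (max_point A)"
  proof
    show "points A \<subseteq> dn (max_point A)"
    proof
      fix a assume "a \<in> points A"
      then have "(a, max_point A) \<in> order A" using m max by (simp add: is_greatest_def)
      then show "a \<in> dn (max_point A)" by (simp add: complete_triplet_order_iff[OF *])
    qed
  qed (rule complete_triplet_dn_subset[OF *])
qed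

lemma complete_triplet_elems_distance:
  "a \<in> points A \<Longrightarrow> (b, r) \<in> fset (elems a) \<Longrightarrow> r = distance A a b"
  using complete_triplet_elems_iff by blast

text \<open>The smallest point has no predecessors, hence is the empty set. It is therefore shared
  by any two complete triplets, so the minimum in \<open>triplet_dist\<close> is over a nonempty
  set.\<close>

lemma complete_triplet_bot:
  assumes "a \<in> points A"
  shows "HF {||} \<in> dn a"
proof -
  obtain m where m: "m \<in> points A" "\<And>b. b \<in> points A \<Longrightarrow> m \<in> dn b"
  proof -
    have "\<exists>m. is_smallest A m"
      using A unfolding complete_triplet_def path_metric_def proper_def by simp
    then show ?thesis using that by (auto simp: is_smallest_def complete_triplet_order_iff)
  qed
  have "preds m = {}"
  proof (rule equals0I)
    fix b assume b: "b \<in> preds m"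
    then have "b \<in> dn m" by (simp add: dn_def)
    moreover from this have "m \<in> dn b" using complete_triplet_dn_subset m by auto
    ultimately have "b = m" by (rule dn_antisym)
    with b show False by (simp add: preds_irrefl)
  qed
  then have "elems m = {||}" by (simp add: preds_def bot_fset.rep_eq fset_inject[symmetric])
  then have "m = HF {||}" by (cases m) simp
  then show ?thesis using m assms by blast
qed

text \<open>For comparable points the lower one serves as \<open>c\<close>, so later arguments need
  no distinction between comparable and incomparable pairs.\<close>

lemma complete_triplet_path:
  assumes "a \<in> points A" "b \<in> points A"
  shows "\<exists>c \<in> dn a \<inter> dn b. distance A a b = distance A a c + distance A c b"
proof -
  have zero: "distance A a a = 0" "distance A b b = 0"
    using rational_metric_spaceD(3)[OF complete_triplet_metric] assms by simp_all
  consider "b \<in> dn a" | "a \<in> dn b" | "(a, b) \<notin> order A \<and> (b, a) \<notin> order A"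
    using assms by (auto simp: complete_triplet_order_iff)
  then show ?thesis
  proof cases
    case 1
    then show ?thesis using zero by (intro bexI[of _ b]) auto
  next
    case 2
    then show ?thesis using zero by (intro bexI[of _ a]) auto
  next
    case 3
    then have "\<exists>c\<in>points A. (c, a) \<in> order A \<and> (c, b) \<in> order A \<and>
        distance A a b = distance A a c + distance A c b"
      using A assms unfolding complete_triplet_def path_metric_def by simp
    then show ?thesis using assms by (auto simp: complete_triplet_order_iff)
  qed
qed

end

section \<open>A criterion for completeness\<close>

lemma max_point_eqI:
  assumes "complete_triplet A" "points A = dn z"
  shows "max_point A = z"
  using complete_triplet_max_point(2)[OF assms(1)] assms(2) by (metis dn_antisym dn_refl)

text \<open>Properness is automatic: by induction along the membership relation, an isomorphism between
  two down sets is the identity (Mostowski collapse).\<close>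

lemma complete_tripletI:
  assumes points: "points A = dn z"
    and trans: "\<And>a b. a \<in> points A \<Longrightarrow> b \<in> dn a \<Longrightarrow> dn b \<subseteq> dn a"
    and order: "order A = {(b, a). a \<in> points A \<and> b \<in> dn a}"
    and metric: "rational_metric_space (points A) (distance A)"
    and off: "\<And>x y. \<not> (x \<in> points A \<and> y \<in> points A) \<Longrightarrow> distance A x y = 0"
    and elems: "\<And>a b r. a \<in> points A \<Longrightarrow> (b, r) \<in> fset (elems a) \<Longrightarrow> r = distance A a b"
    and bot: "\<And>a. a \<in> points A \<Longrightarrow> HF {||} \<in> dn a"
    and path: "\<And>a b. a \<in> points A \<Longrightarrow> b \<in> points A \<Longrightarrow>
      \<exists>c \<in> dn a \<inter> dn b. distance A a b = distance A a c + distance A c b"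
  shows "complete_triplet A"
proof -
  have sub: "dn a \<subseteq> points A" if "a \<in> points A" for a
    using trans[of z a] that points by auto
  have po: "partial_order_on (points A) (order A)"
    unfolding partial_order_on_def preorder_on_def
  proof (intro conjI)
    show "order A \<subseteq> points A \<times> points A" using sub order by auto
    show "refl_on (points A) (order A)" using order by (auto simp: refl_on_def)
    show "Relation.trans (order A)"
    proof (rule transI)
      fix x y w assume "(x, y) \<in> order A" "(y, w) \<in> order A"
      then have "x \<in> dn y" "y \<in> dn w" "w \<in> points A" using order by auto
      then show "(x, w) \<in> order A" using order trans[of w y] by auto
    qed
    show "antisym (order A)" using order dn_antisym by (auto simp: antisym_def)
  qed
  have triplet: "triplet A"
    unfolding triplet_def using po metric off points by simp
  have greatest: "is_greatest A z"
    unfolding is_greatest_def using points order by auto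
  have smallest: "is_smallest A (HF {||})"
    unfolding is_smallest_def using points order bot sub[of z] by auto
  have down_points: "points (down A a) = dn a" if "a \<in> points A" for a
    using that sub[OF that] order by (auto simp: down_def induced_def)
  have down_order: "(x, y) \<in> order (down A a) \<longleftrightarrow> x \<in> dn y"
    if "a \<in> points A" "x \<in> dn a" "y \<in> dn a" for a x y
    using that sub[OF that(1)] order by (auto simp: down_def induced_def)
  have down_distance: "distance (down A a) x y = distance A x y"
    if "a \<in> points A" "x \<in> dn a" "y \<in> dn a" for a x y
    using that sub[OF that(1)] order by (auto simp: down_def induced_def)
  have elems_iff: "fset (elems a) = {(b, distance A a b) | b. b \<in> dn a \<and> b \<noteq> a}" (is "_ = ?R")
    if "a \<in> points A" for a
  proof
    show "fset (elems a) \<subseteq> ?R"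
    proof
      fix p assume p: "p \<in> fset (elems a)"
      obtain b r where [simp]: "p = (b, r)" by fastforce
      have "b \<in> preds a" using p by (force simp: preds_def)
      then have "b \<in> dn a \<and> b \<noteq> a" using preds_irrefl by (auto simp: dn_def)
      then show "p \<in> ?R" using elems[OF that, of b r] p by auto
    qed
    \<comment> \<open>A predecessor \<open>b\<close> is paired with some \<open>r\<close> in
      \<open>a\<close>, and \<open>elems\<close> forces \<open>r\<close> to be the distance.\<close>
    show "?R \<subseteq> fset (elems a)"
      using elems[OF that] by (force simp: dn_def preds_def)
  qed
  have rigid: "a = b"
    if ab: "a \<in> points A" "b \<in> points A" and iso: "triplet_isomorphic (down A a) (down A b)" for a b
  proof -
    obtain f where bij: "bij_betw f (dn a) (dn b)"
      and f: "\<And>x y. x \<in> dn a \<Longrightarrow> y \<in> dn a \<Longrightarrow>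
        (x \<in> dn y \<longleftrightarrow> f x \<in> dn (f y)) \<and> distance A (f x) (f y) = distance A x y"
    proof -
      obtain f where bij: "bij_betw f (dn a) (dn b)"
        and f: "\<And>x y. x \<in> dn a \<Longrightarrow> y \<in> dn a \<Longrightarrow>
        ((x, y) \<in> order (down A a) \<longleftrightarrow> (f x, f y) \<in> order (down A b)) \<and>
        distance (down A b) (f x) (f y) = distance (down A a) x y"
        using iso unfolding triplet_isomorphic_def down_points[OF ab(1)] down_points[OF ab(2)] by blast
      have "f x \<in> dn b" if "x \<in> dn a" for x using bij that by (auto simp: bij_betw_def)
      then show ?thesis
        using that[OF bij] f down_order down_distance ab by simp
    qed
    have fdn: "f x \<in> dn b" if "x \<in> dn a" for x using bij that by (auto simp: bij_betw_def)
    have "x \<in> dn a \<longrightarrow> f x = x" for x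
    proof (induction x rule: hfset_preds_induct)
      case (1 x)
      show ?case
      proof
        assume x: "x \<in> dn a"
        have xA: "x \<in> points A" "f x \<in> points A" using sub ab x fdn by blast+
        have IH: "f y = y" if "y \<in> dn x" "y \<noteq> x" for y
          using 1[of y] that trans[OF ab(1) x] by (auto simp: dn_def)
        \<comment> \<open>The strict predecessors of \<open>f x\<close> are images of those of
          \<open>x\<close>, at equal distances, and \<open>f\<close> fixes the latter by induction;
          so \<open>x\<close> and \<open>f x\<close> have the same elements.\<close>
        have "{(c, distance A (f x) c) | c. c \<in> dn (f x) \<and> c \<noteq> f x} =
              {(y, distance A x y) | y. y \<in> dn x \<and> y \<noteq> x}" (is "?L = ?R")
        proof
          show "?L \<subseteq> ?R"
          proof clarify
            fix c assume c: "c \<in> dn (f x)" "c \<noteq> f x"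
            then have "c \<in> dn b" using trans[OF ab(2) fdn[OF x]] by blast
            then obtain y where y: "y \<in> dn a" "c = f y" using bij by (auto simp: bij_betw_def)
            then have "y \<in> dn x" "y \<noteq> x" using c f[OF y(1) x] by auto
            then show "\<exists>y. (c, distance A (f x) c) = (y, distance A x y) \<and> y \<in> dn x \<and> y \<noteq> x"
              using IH[of y] y f[OF x y(1)] by auto
          qed
          show "?R \<subseteq> ?L"
          proof clarify
            fix y assume y: "y \<in> dn x" "y \<noteq> x"
            have ya: "y \<in> dn a" using y trans[OF ab(1) x] by blast
            have fy: "f y = y" using IH y by blast
            have "y \<in> dn (f x)" "distance A (f x) y = distance A x y"
              using f[OF ya x] f[OF x ya] fy y by auto
            moreover have "y \<noteq> f x"
              using fy bij x ya y by (metis bij_betw_inv_into_left)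
            ultimately show "\<exists>c. (y, distance A x y) = (c, distance A (f x) c) \<and> c \<in> dn (f x) \<and> c \<noteq> f x"
              by auto
          qed
        qed
        then have "elems (f x) = elems x"
          unfolding fset_inject[symmetric] elems_iff[OF xA(1)] elems_iff[OF xA(2)] .
        then show "f x = x" by (cases x; cases "f x") simp
      qed
    qed
    then have "dn a = dn b" using bij by (force simp: bij_betw_def image_iff)
    then show "a = b" using dn_antisym dn_refl by metis
  qed
  have "proper A"
    unfolding proper_def using triplet greatest smallest rigid by blast
  moreover have "\<exists>a''\<in>points A. (a'', a) \<in> order A \<and> (a'', a') \<in> order A \<and>
      distance A a a' = distance A a a'' + distance A a'' a'"
    if "a \<in> points A" "a' \<in> points A" for a a'
    using path[OF that] that sub order by blast
  ultimately show "complete_triplet A"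
    unfolding complete_triplet_def path_metric_def using elems_iff down_points by simp
qed

section \<open>Agreement of complete triplets and their down sets\<close>

text \<open>A shortest path in \<open>B\<close> runs through a common lower bound \<open>c\<close>.
  Distances from a point down to \<open>c\<close> are recorded in the point itself, so the path has
  the same length in \<open>A\<close>, and the triangle inequality there suffices. Exchanging
  \<open>A\<close> and \<open>B\<close> gives equality.\<close>

lemma complete_triplet_distance_le:
  assumes A: "complete_triplet A" and B: "complete_triplet B"
    and a: "a \<in> points A" "a \<in> points B" and b: "b \<in> points A" "b \<in> points B"
  shows "distance A a b \<le> distance B a b"
proof -
  note mA = rational_metric_spaceD[OF complete_triplet_metric[OF A]]
  note mB = rational_metric_spaceD[OF complete_triplet_metric[OF B]]
  have below: "distance A x c = distance B x c"
    if x: "x \<in> points A" "x \<in> points B" and c: "c \<in> dn x" for x c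
  proof (cases "c = x")
    case True
    then show ?thesis using mA(3)[of x x] mB(3)[of x x] x by simp
  next
    case False
    then obtain r where "(c, r) \<in> fset (elems x)" using c by (auto simp: dn_def preds_def)
    then show ?thesis
      using complete_triplet_elems_distance[OF A x(1), of c r] complete_triplet_elems_distance[OF B x(2), of c r]
      by simp
  qed
  obtain c where c: "c \<in> dn a" "c \<in> dn b" and eq: "distance B a b = distance B a c + distance B c b"
    using complete_triplet_path[OF B a(2) b(2)] by auto
  have cA: "c \<in> points A" and cB: "c \<in> points B"
    using c complete_triplet_dn_subset[OF A a(1)] complete_triplet_dn_subset[OF B a(2)] by auto
  have "distance A a b \<le> distance A a c + distance A b c"
    using mA(4)[OF a(1) cA b(1)] mA(2)[OF b(1) cA] by simp
  also have "\<dots> = distance B a c + distance B b c"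
    using below[OF a c(1)] below[OF b c(2)] by simp
  also have "\<dots> = distance B a b"
    using eq mB(2)[OF b(2) cB] by simp
  finally show ?thesis .
qed

text \<open>The intermediate point of a path lies below both ends, so a down set inherits the path
  condition. Thus every point of a triplet stands for an element of the space.\<close>

lemma complete_triplet_down:
  assumes A: "complete_triplet A" and a: "a \<in> points A"
  shows "complete_triplet (down A a)" "max_point (down A a) = a" "points (down A a) = dn a"
    and "b \<in> dn a \<Longrightarrow> c \<in> dn a \<Longrightarrow> distance (down A a) b c = distance A b c"
proof -
  have sub: "dn a \<subseteq> points A" by (rule complete_triplet_dn_subset[OF A a])
  have trans: "dn b \<subseteq> dn a" if "b \<in> dn a" for b
    by (rule complete_triplet_dn_trans[OF A a that])
  have "{b \<in> points A. (b, a) \<in> order A} = dn a"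
    using sub a by (auto simp: complete_triplet_order[OF A])
  then have down: "down A a = \<lparr>points = dn a, order = order A \<inter> dn a \<times> dn a,
      distance = (\<lambda>x y. if x \<in> dn a \<and> y \<in> dn a then distance A x y else 0)\<rparr>"
    by (simp add: down_def induced_def)
  then show points: "points (down A a) = dn a"
    and dist: "b \<in> dn a \<Longrightarrow> c \<in> dn a \<Longrightarrow> distance (down A a) b c = distance A b c" for b c
    by simp_all
  have "rational_metric_space (dn a) (distance A)"
    using rational_metric_space_subset[OF complete_triplet_metric[OF A] sub] .
  moreover have "rational_metric_space (dn a) (distance (down A a)) \<longleftrightarrow> rational_metric_space (dn a) (distance A)"
    using dist by (rule rational_metric_space_cong)
  ultimately have metric: "rational_metric_space (dn a) (distance (down A a))" by simp
  show "complete_triplet (down A a)"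
  proof (rule complete_tripletI[of "down A a" a])
    show "order (down A a) = {(b, c). c \<in> points (down A a) \<and> b \<in> dn c}"
      using sub trans by (auto simp: down complete_triplet_order[OF A])
    show "rational_metric_space (points (down A a)) (distance (down A a))"
      using metric points by simp
    fix b c assume "b \<in> points (down A a)"
    then have b: "b \<in> dn a" "b \<in> points A" using points sub by auto
    show "HF {||} \<in> dn b" by (rule complete_triplet_bot[OF A b(2)])
    show "dn c \<subseteq> dn b" if "c \<in> dn b" by (rule complete_triplet_dn_trans[OF A b(2) that])
    show "r = distance (down A a) b c" if "(c, r) \<in> fset (elems b)" for r
    proof -
      have "c \<in> dn b" using that by (force simp: dn_def preds_def)
      then have "c \<in> dn a" using trans b by auto
      then show ?thesis using complete_triplet_elems_distance[OF A b(2) that] dist b by simp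
    qed
    assume "c \<in> points (down A a)"
    then have c: "c \<in> dn a" "c \<in> points A" using points sub by auto
    obtain x where x: "x \<in> dn b" "x \<in> dn c" "distance A b c = distance A b x + distance A x c"
      using complete_triplet_path[OF A b(2) c(2)] by auto
    moreover have "x \<in> dn a" using x trans b by auto
    ultimately show "\<exists>x\<in>dn b \<inter> dn c. distance (down A a) b c = distance (down A a) b x + distance (down A a) x c"
      using dist b c by (intro bexI[of _ x]) simp_all
  qed (auto simp: down)
  then show "max_point (down A a) = a" using points by (rule max_point_eqI)
qed

lemma complete_triplet_eqI:
  assumes A: "complete_triplet A" and B: "complete_triplet B" and eq: "max_point A = max_point B"
  shows "A = B"
proof -
  have points: "points A = points B"
    using complete_triplet_max_point(2)[OF A] complete_triplet_max_point(2)[OF B] eq by simp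
  then have order: "order A = order B"
    using complete_triplet_order[OF A] complete_triplet_order[OF B] by simp
  have "distance A x y = distance B x y" for x y
  proof (cases "x \<in> points A \<and> y \<in> points A")
    case True
    then show ?thesis
      using complete_triplet_distance_le[OF A B, of x y] complete_triplet_distance_le[OF B A, of x y]
        points by simp
  next
    case False
    then show ?thesis
      using complete_triplet_distance_off[OF A, of x y] complete_triplet_distance_off[OF B, of x y]
        points by auto
  qed
  then have "distance A = distance B" by (simp add: fun_eq_iff)
  with points order show ?thesis by simp
qed

text \<open>Both sides have the same maximum. Triplets whose maxima lie in one \<open>B\<close>
  thereby become down sets of \<open>B\<close>, and their distance can be computed inside
  \<open>B\<close>.\<close>

lemma down_eq:
  assumes "complete_triplet A" "complete_triplet B" "max_point A \<in> points B"
  shows "A = down B (max_point A)"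
  using complete_triplet_eqI complete_triplet_down(1,2) assms by simp

text \<open>Coding a triplet by its maximum yields countability; the inverse of the coding turns
  points back into triplets.\<close>

lemma inj_on_max_point: "inj_on max_point complete_triplets"
  by (rule inj_onI) (simp add: complete_triplets_def complete_triplet_eqI)

section \<open>The metric on the set of complete triplets\<close>

context
  fixes A B assumes A: "complete_triplet A" and B: "complete_triplet B"
begin

private lemma triplet_dist_image:
  "triplet_dist A B =
     Min ((\<lambda>c. distance A (max_point A) c + distance B (max_point B) c) ` (points A \<inter> points B))"
  unfolding triplet_dist_def by (rule arg_cong[of _ _ Min]) auto

private lemma finite_points: "finite (points A \<inter> points B)"
  using complete_triplet_max_point(2)[OF A] by simp

lemma triplet_dist_le:
  "c \<in> points A \<Longrightarrow> c \<in> points B \<Longrightarrow>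
    triplet_dist A B \<le> distance A (max_point A) c + distance B (max_point B) c"
  unfolding triplet_dist_image using finite_points by (intro Min_le) auto

lemma triplet_dist_attained:
  obtains c where "c \<in> points A" "c \<in> points B"
    "triplet_dist A B = distance A (max_point A) c + distance B (max_point B) c"
proof -
  have "HF {||} \<in> points A \<inter> points B"
    using complete_triplet_bot[OF A complete_triplet_max_point(1)[OF A]]
      complete_triplet_bot[OF B complete_triplet_max_point(1)[OF B]]
      complete_triplet_max_point(2)[OF A] complete_triplet_max_point(2)[OF B] by simp
  then have "triplet_dist A B \<in>
      (\<lambda>c. distance A (max_point A) c + distance B (max_point B) c) ` (points A \<inter> points B)"
    unfolding triplet_dist_image using finite_points by (intro Min_in) auto
  then show ?thesis using that by auto
qed

end

lemma triplet_dist_commute: "triplet_dist A B = triplet_dist B A"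
  unfolding triplet_dist_def by (rule arg_cong[of _ _ Min]) (auto simp: add.commute)

text \<open>The path condition makes \<open>distance A a b\<close> one of the sums being minimised,
  and the triangle inequality in \<open>A\<close> makes it a lower bound for all of them.\<close>

lemma triplet_dist_down:
  assumes A: "complete_triplet A" and a: "a \<in> points A" and b: "b \<in> points A"
  shows "triplet_dist (down A a) (down A b) = distance A a b"
proof (rule antisym)
  note m = rational_metric_spaceD[OF complete_triplet_metric[OF A]]
  note da = complete_triplet_down[OF A a] and db = complete_triplet_down[OF A b]
  obtain c where c: "c \<in> dn a" "c \<in> dn b" and eq: "distance A a b = distance A a c + distance A c b"
    using complete_triplet_path[OF A a b] by auto
  then have cA: "c \<in> points A" using complete_triplet_dn_subset[OF A a] by auto
  show "triplet_dist (down A a) (down A b) \<le> distance A a b"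
    using triplet_dist_le[OF da(1) db(1), of c] c eq m(2)[OF cA b] by (simp add: da db)
  obtain c' where c': "c' \<in> points (down A a)" "c' \<in> points (down A b)"
    "triplet_dist (down A a) (down A b) =
      distance (down A a) (max_point (down A a)) c' + distance (down A b) (max_point (down A b)) c'"
    using triplet_dist_attained[OF da(1) db(1)] .
  then have c'A: "c' \<in> points A" using complete_triplet_dn_subset[OF A a] da(3) by auto
  have "triplet_dist (down A a) (down A b) = distance A a c' + distance A b c'"
    using c' by (simp add: da db)
  then show "distance A a b \<le> triplet_dist (down A a) (down A b)"
    using m(4)[OF a c'A b] m(2)[OF b c'A] by simp
qed

text \<open>The two minima are attained at points \<open>a\<close> and \<open>b\<close> of
  \<open>B\<close>. A point \<open>c\<close> below both, on a shortest path between them in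
  \<open>B\<close>, belongs to \<open>A\<close> through \<open>a\<close> and to \<open>C\<close>
  through \<open>b\<close>, so it competes in the minimum for \<open>A\<close> and
  \<open>C\<close>.\<close>

lemma triplet_dist_triangle:
  assumes A: "complete_triplet A" and B: "complete_triplet B" and C: "complete_triplet C"
  shows "triplet_dist A C \<le> triplet_dist A B + triplet_dist B C"
proof -
  obtain a where a: "a \<in> points A" "a \<in> points B"
    and ab: "triplet_dist A B = distance A (max_point A) a + distance B (max_point B) a"
    using triplet_dist_attained[OF A B] .
  obtain b where b: "b \<in> points B" "b \<in> points C"
    and bc: "triplet_dist B C = distance B (max_point B) b + distance C (max_point C) b"
    using triplet_dist_attained[OF B C] .
  obtain c where c: "c \<in> dn a" "c \<in> dn b" and eq: "distance B a b = distance B a c + distance B c b"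
    using complete_triplet_path[OF B a(2) b(1)] by auto
  have cP: "c \<in> points A" "c \<in> points B" "c \<in> points C"
    using c complete_triplet_dn_subset[OF A a(1)] complete_triplet_dn_subset[OF B a(2)]
      complete_triplet_dn_subset[OF C b(2)] by auto
  note mA = rational_metric_spaceD[OF complete_triplet_metric[OF A]]
  note mB = rational_metric_spaceD[OF complete_triplet_metric[OF B]]
  note mC = rational_metric_spaceD[OF complete_triplet_metric[OF C]]
  note max = complete_triplet_max_point(1)
  have "triplet_dist A C \<le> distance A (max_point A) c + distance C (max_point C) c"
    using triplet_dist_le[OF A C cP(1,3)] .
  also have "\<dots> \<le> (distance A (max_point A) a + distance A a c) + (distance C (max_point C) b + distance C b c)"
    using mA(4)[OF max[OF A] a(1) cP(1)] mC(4)[OF max[OF C] b(2) cP(3)] by simp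
  also have "\<dots> \<le> (distance A (max_point A) a + distance B a c) + (distance C (max_point C) b + distance B b c)"
    using complete_triplet_distance_le[OF A B a cP(1,2)]
      complete_triplet_distance_le[OF C B b(2,1) cP(3,2)] by simp
  also have "\<dots> = distance A (max_point A) a + distance C (max_point C) b + distance B a b"
    using eq mB(2)[OF b(1) cP(2)] by simp
  also have "\<dots> \<le> distance A (max_point A) a + distance C (max_point C) b +
      (distance B (max_point B) a + distance B (max_point B) b)"
    using mB(4)[OF a(2) max[OF B] b(1)] mB(2)[OF a(2) max[OF B]] by simp
  finally show ?thesis using ab bc by simp
qed

lemma triplet_dist_eq_0_iff:
  assumes A: "complete_triplet A" and B: "complete_triplet B"
  shows "triplet_dist A B = 0 \<longleftrightarrow> A = B"
proof
  note max = complete_triplet_max_point(1)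
  note mA = rational_metric_spaceD[OF complete_triplet_metric[OF A] max[OF A]]
  note mB = rational_metric_spaceD[OF complete_triplet_metric[OF B] max[OF B]]
  obtain c where c: "c \<in> points A" "c \<in> points B"
    and eq: "triplet_dist A B = distance A (max_point A) c + distance B (max_point B) c"
    using triplet_dist_attained[OF A B] .
  show "A = B" if "triplet_dist A B = 0"
  proof (rule complete_triplet_eqI[OF A B])
    have "distance A (max_point A) c = 0" "distance B (max_point B) c = 0"
      using that eq mA(1)[OF c(1)] mB(1)[OF c(2)] by simp_all
    then have "max_point A = c" "max_point B = c" using mA(3)[OF c(1)] mB(3)[OF c(2)] by simp_all
    then show "max_point A = max_point B" by simp
  qed
  show "triplet_dist A B = 0" if "A = B"
  proof -
    have "A = down A (max_point A)" using down_eq[OF A A max[OF A]] .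
    then have "triplet_dist A A = distance A (max_point A) (max_point A)"
      using triplet_dist_down[OF A max[OF A] max[OF A]] by simp
    then show ?thesis using that mA(3)[OF max[OF A]] by simp
  qed
qed

lemma rational_metric_space_triplet_dist: "rational_metric_space complete_triplets triplet_dist"
  by (rule rational_metric_spaceI)
    (simp_all add: complete_triplets_def triplet_dist_commute triplet_dist_triangle triplet_dist_eq_0_iff)

lemma countable_complete_triplets: "countable complete_triplets"
  using countable_image_inj_on[OF countableI_type inj_on_max_point] .

section \<open>Realising Katetov functions\<close>

lemma fset_elems_HF_image:
  assumes "finite S"
  shows "fset (elems (HF (Abs_fset ((\<lambda>s. (s, g s)) ` S)))) = (\<lambda>s. (s, g s)) ` S"
  using assms by (simp add: Abs_fset_inverse)

text \<open>To realise a Katetov function \<open>f\<close> on a finite set \<open>F\<close> of complete triplets, extend it to all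
  complete triplets and form the point whose members are the points \<open>s\<close> of the triplets in \<open>F\<close>,
  each paired with the value at \<open>s\<close> of the extended function.\<close>

lemma extension_property_complete_triplets: "extension_property complete_triplets triplet_dist"
  unfolding extension_property_def
proof (intro conjI allI impI, goal_cases)
  case 1
  \<comment> \<open>The triplet whose only point is the empty set shows that the space is
    nonempty.\<close>
  let ?A = "\<lparr>points = {HF {||}}, order = {(HF {||}, HF {||})}, distance = (\<lambda>_ _. 0)\<rparr>"
  have "complete_triplet ?A"
    by (rule complete_tripletI[of ?A "HF {||}"]) (auto simp: dn_def intro!: rational_metric_spaceI)
  then show ?case by (auto simp: complete_triplets_def)
next
  case (2 F f)
  then have F: "finite F" "F \<subseteq> complete_triplets" "F \<noteq> {}" "katetov F triplet_dist f" by auto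
  have FC: "complete_triplet A" if "A \<in> F" for A
    using F(2) that by (auto simp: complete_triplets_def)
  obtain g where g: "katetov complete_triplets triplet_dist g" "\<And>A. A \<in> F \<Longrightarrow> g A = f A"
    by (rule katetov_extend[OF rational_metric_space_triplet_dist F(2,1,3,4)]) blast
  define S where "S = (\<Union>A\<in>F. points A)"
  \<comment> \<open>\<open>T s\<close> is the triplet with maximum \<open>s\<close>. Through it
    \<open>D\<close> becomes one metric on the whole union \<open>S\<close>, agreeing with
    \<open>distance A\<close> on each \<open>A\<close> in \<open>F\<close>, and \<open>h\<close>
    becomes a Katetov function for it.\<close>
  define T where "T = inv_into complete_triplets max_point"
  define D where "D s t = triplet_dist (T s) (T t)" for s t
  define h where "h s = g (T s)" for s
  have T: "T (max_point A) = A" if "complete_triplet A" for A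
    unfolding T_def using inv_into_f_f[OF inj_on_max_point] that by (simp add: complete_triplets_def)
  have T_down: "T s = down A s" if "complete_triplet A" "s \<in> points A" for A s
    using T[OF complete_triplet_down(1)[OF that]] complete_triplet_down(2)[OF that] by simp
  have D: "D s t = distance A s t" if "complete_triplet A" "s \<in> points A" "t \<in> points A" for A s t
    unfolding D_def using T_down that triplet_dist_down by simp
  have S: "\<exists>A\<in>F. s \<in> points A" if "s \<in> S" for s
    using that by (auto simp: S_def)
  have T_S: "complete_triplet (T s)" "max_point (T s) = s" if "s \<in> S" for s
  proof -
    obtain A where A: "A \<in> F" "s \<in> points A" using S[OF \<open>s \<in> S\<close>] by auto
    then show "complete_triplet (T s)" "max_point (T s) = s"
      using T_down[OF FC[OF A(1)] A(2)] complete_triplet_down(1,2)[OF FC[OF A(1)] A(2)] by simp_all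
  qed
  have inj_T: "inj_on T S" by (rule inj_on_inverseI[where g = max_point]) (rule T_S(2))
  have img_T: "T ` S \<subseteq> complete_triplets" using T_S(1) by (auto simp: complete_triplets_def)
  have finS: "finite S"
    unfolding S_def
  proof (rule finite_UN_I[OF F(1)])
    show "finite (points A)" if "A \<in> F" for A
      by (subst complete_triplet_max_point(2)[OF FC[OF that]]) simp
  qed
  have dnS: "dn s \<subseteq> S" "HF {||} \<in> dn s" if "s \<in> S" for s
  proof -
    obtain A where A: "A \<in> F" "s \<in> points A" using S[OF \<open>s \<in> S\<close>] by auto
    show "dn s \<subseteq> S" using complete_triplet_dn_subset[OF FC[OF A(1)] A(2)] A(1) by (auto simp: S_def)
    show "HF {||} \<in> dn s" by (rule complete_triplet_bot[OF FC[OF A(1)] A(2)])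
  qed
  have dn_trans: "dn t \<subseteq> dn s" if "s \<in> S" "t \<in> dn s" for s t
  proof -
    obtain A where A: "A \<in> F" "s \<in> points A" using S[OF \<open>s \<in> S\<close>] by auto
    show ?thesis by (rule complete_triplet_dn_trans[OF FC[OF A(1)] A(2) that(2)])
  qed
  have metric_S: "rational_metric_space S D"
    unfolding D_def by (rule rational_metric_space_inj_image[OF rational_metric_space_triplet_dist inj_T img_T])
  have kat_S: "katetov S D h"
    using g(1) img_T unfolding katetov_def D_def h_def by (simp add: image_subset_iff)
  have elems_S: "r = D s b" if "s \<in> S" "(b, r) \<in> fset (elems s)" for s b r
  proof -
    obtain A where A: "A \<in> F" "s \<in> points A" using S[OF \<open>s \<in> S\<close>] by auto
    note cA = FC[OF A(1)]
    have "b \<in> dn s" using that(2) by (force simp: dn_def preds_def)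
    then have "b \<in> points A" using complete_triplet_dn_subset[OF cA A(2)] by auto
    then show ?thesis
      using complete_triplet_elems_distance[OF cA A(2) that(2)] D[OF cA A(2)] by simp
  qed
  \<comment> \<open>As \<open>s\<close> and \<open>t\<close> may come from different triplets, no
    single path condition applies; a point attaining the minimum in
    \<open>triplet_dist (T s) (T t)\<close> is the required \<open>c\<close>.\<close>
  have path_S: "\<exists>c\<in>dn s \<inter> dn t. D s t = D s c + D c t" if "s \<in> S" "t \<in> S" for s t
  proof -
    note Ts = T_S(1)[OF that(1)] and Tt = T_S(1)[OF that(2)]
    note max = T_S(2)[OF that(1)] T_S(2)[OF that(2)]
    obtain c where c: "c \<in> points (T s)" "c \<in> points (T t)"
      and eq: "triplet_dist (T s) (T t) = distance (T s) s c + distance (T t) t c"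
      using triplet_dist_attained[OF Ts Tt] unfolding max .
    have "s \<in> points (T s)" "t \<in> points (T t)"
      using complete_triplet_max_point(1)[OF Ts] complete_triplet_max_point(1)[OF Tt] unfolding max .
    then have "D s c = distance (T s) s c" "D t c = distance (T t) t c"
      using D[OF Ts _ c(1)] D[OF Tt _ c(2)] by simp_all
    moreover have cdn: "c \<in> dn s" "c \<in> dn t"
      using c complete_triplet_max_point(2)[OF Ts] complete_triplet_max_point(2)[OF Tt] unfolding max by simp_all
    moreover have "D t c = D c t" by (simp add: D_def triplet_dist_commute)
    ultimately show ?thesis using eq by (intro bexI[of _ c]) (simp_all add: D_def)
  qed
  define z where "z = HF (Abs_fset ((\<lambda>s. (s, h s)) ` S))"
  have elems_z: "fset (elems z) = (\<lambda>s. (s, h s)) ` S"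
    unfolding z_def by (rule fset_elems_HF_image[OF finS])
  then have preds_z: "preds z = S" by (force simp: preds_def)
  \<comment> \<open>Well-foundedness makes \<open>z\<close> new, since all of \<open>S\<close>
    precedes it.\<close>
  then have zS: "z \<notin> S" using preds_irrefl by auto
  have dn_z: "dn z = insert z S" by (simp add: dn_def preds_z)
  define E where "E x y = (if x = y then 0 else if x = z then h y else if y = z then h x else D x y)" for x y
  define Z where "Z = \<lparr>points = insert z S, order = {(b, a). a \<in> insert z S \<and> b \<in> dn a},
    distance = (\<lambda>x y. if x \<in> insert z S \<and> y \<in> insert z S then E x y else 0)\<rparr>"
  have E_S: "E s t = D s t" if "s \<in> S" "t \<in> S" for s t
    using that zS rational_metric_spaceD(3)[OF metric_S, of s t] by (auto simp: E_def)
  have Z: "complete_triplet Z"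
  proof (rule complete_tripletI)
    show "points Z = dn z" by (simp add: Z_def dn_z)
    show "order Z = {(b, a). a \<in> points Z \<and> b \<in> dn a}" by (simp add: Z_def)
    have "rational_metric_space (insert z S) E"
      unfolding E_def by (rule rational_metric_space_insert[OF metric_S kat_S zS])
    then show "rational_metric_space (points Z) (distance Z)"
      by (subst rational_metric_space_cong[where e = E]) (simp_all add: Z_def)
    show "distance Z x y = 0" if "\<not> (x \<in> points Z \<and> y \<in> points Z)" for x y
      using that by (auto simp: Z_def)
    fix a assume "a \<in> points Z"
    then have a: "a = z \<or> a \<in> S" by (simp add: Z_def)
    \<comment> \<open>A member of \<open>F\<close> brings the empty set into \<open>S\<close>, and
      so below \<open>z\<close>.\<close>
    obtain A where "A \<in> F" using F(3) by auto
    then have "max_point A \<in> S" using complete_triplet_max_point(1)[OF FC] by (auto simp: S_def)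
    then have "HF {||} \<in> S" using dnS by auto
    then show "HF {||} \<in> dn a" using a dnS(2) by (auto simp: dn_z)
    show "dn b \<subseteq> dn a" if "b \<in> dn a" for b
      using a that dn_trans[of a b] dnS(1)[of b] by (auto simp: dn_z subset_iff)
    show "r = distance Z a b" if "(b, r) \<in> fset (elems a)" for b r
      using a
    proof
      assume "a = z"
      then have "b \<in> S" "r = h b" using that elems_z by auto
      then show ?thesis using \<open>a = z\<close> zS by (auto simp: Z_def E_def)
    next
      assume a: "a \<in> S"
      have "b \<in> dn a" using that by (force simp: dn_def preds_def)
      then have "b \<in> S" using dnS(1) a by auto
      then show ?thesis using a elems_S[OF a that] E_S by (simp add: Z_def)
    qed
    fix b assume "b \<in> points Z"
    then have b: "b = z \<or> b \<in> S" by (simp add: Z_def)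
    have "\<exists>c\<in>dn a \<inter> dn b. E a b = E a c + E c b"
    proof (cases "a = z \<or> b = z")
      case True
      \<comment> \<open>Everything lies below \<open>z\<close>, so the new point creates no
        incomparable pairs.\<close>
      then have "a \<in> dn b \<or> b \<in> dn a" using a b by (auto simp: dn_z)
      then show ?thesis
      proof
        assume "a \<in> dn b"
        then show ?thesis by (intro bexI[of _ a]) (auto simp: E_def)
      next
        assume "b \<in> dn a"
        then show ?thesis by (intro bexI[of _ b]) (auto simp: E_def)
      qed
    next
      case False
      then have ab: "a \<in> S" "b \<in> S" using a b by auto
      obtain c where c: "c \<in> dn a \<inter> dn b" "D a b = D a c + D c b" using path_S[OF ab] by auto
      then have "c \<in> S" using dnS(1) ab by auto
      then show ?thesis using c E_S ab by (intro bexI[of _ c]) simp_all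
    qed
    then obtain c where c: "c \<in> dn a \<inter> dn b" "E a b = E a c + E c b" by auto
    have "c \<in> insert z S" using c(1) a dnS(1)[of a] by (auto simp: dn_z subset_iff)
    then show "\<exists>c\<in>dn a \<inter> dn b. distance Z a b = distance Z a c + distance Z c b"
      using c a b by (intro bexI[of _ c]) (simp_all add: Z_def)
  qed
  have max_Z: "max_point Z = z"
    by (rule max_point_eqI[OF Z]) (simp add: Z_def dn_z)
  show ?case
  proof (intro bexI[of _ Z] ballI)
    fix A assume A: "A \<in> F"
    then have m: "max_point A \<in> S" using complete_triplet_max_point(1)[OF FC] by (auto simp: S_def)
    then have mZ: "max_point A \<in> points Z" "z \<in> points Z" by (simp_all add: Z_def)
    \<comment> \<open>Both triplets are down sets of \<open>Z\<close>, so their distance is the one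
      from \<open>z\<close> to \<open>max_point A\<close> in \<open>Z\<close>, which was set to
      \<open>h (max_point A)\<close>.\<close>
    have "Z = down Z z" using down_eq[OF Z Z] max_Z mZ(2) by simp
    moreover have "A = down Z (max_point A)" using down_eq[OF FC[OF A] Z mZ(1)] .
    ultimately have "triplet_dist Z A = triplet_dist (down Z z) (down Z (max_point A))" by simp
    also have "\<dots> = distance Z z (max_point A)" by (rule triplet_dist_down[OF Z mZ(2,1)])
    also have "\<dots> = h (max_point A)" using m zS by (auto simp: Z_def E_def)
    also have "\<dots> = f A" using T[OF FC[OF A]] g(2)[OF A] by (simp add: h_def)
    finally show "triplet_dist Z A = f A" .
  qed (simp add: Z complete_triplets_def)
qed

theorem theorem5p6:
  shows "countable complete_triplets \<and>
         rational_metric_space complete_triplets triplet_dist \<and>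
         ultrahomogeneous complete_triplets triplet_dist \<and>
         (\<forall>(X :: 'a set) e. countable X \<and> rational_metric_space X e \<longrightarrow>
            embeds_isometrically X e complete_triplets triplet_dist)"
proof (intro conjI allI impI, goal_cases)
  case 3
  show ?case
    using rational_metric_space_triplet_dist countable_complete_triplets extension_property_complete_triplets
    by (rule extension_property_imp_ultrahomogeneous)
next
  case (4 X e)
  then have "rational_metric_space X e" "countable X" by simp_all
  then show ?case
    using rational_metric_space_triplet_dist extension_property_complete_triplets
    by (rule extension_property_imp_universal)
qed (rule countable_complete_triplets, rule rational_metric_space_triplet_dist)

end
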